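(* Let $\mathcal{X}$ be a non-empty finite set, and let $\check n,\hat n\geq1$ be integers with $N=\check n+\hat n$. Let $\mathcal{R}\subseteq\mathcal{G}(\mathcal{X}^N)$ be a coherent and exchangeable set of gambles on $\mathcal{X}^N$, with count representation $\mathcal{S}=\mathrm{Hy}^N(\mathcal{R})$. Let $\check m\in\mathcal{N}^{\check n}$, and let $\mathcal{S}\rfloor\check m:=\mathrm{Hy}^{\hat n}(\mathcal{R}\rfloor\check m)$ be the count representation of the coherent and exchangeable set of gambles $\mathcal{R}\rfloor\check m$ on $\mathcal{X}^{\hat n}$ obtained after updating $\mathcal{R}$ with a sample $\check x\in\mathcal{X}^{\check n}$ with count vector $\check m$. Then $$\mathcal{S}\rfloor\check m=\{g\in\mathcal{G}(\mathcal{N}^{\hat n}):+_{\check m}(L_{\check m}g)\in\mathcal{S}\}.$$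
   Context: A gamble on a non-empty set $\Omega$ is a bounded function $\Omega\to\mathbb{R}$; $\mathcal{G}(\Omega)$ is the linear space of all gambles on $\Omega$. Write $f\geq g$ for the pointwise ordering, and $f>g$ iff $f\geq g$ and $f\neq g$. A set $\mathcal{R}\subseteq\mathcal{G}(\Omega)$ is coherent if: $0\notin\mathcal{R}$; $f>0$ implies $f\in\mathcal{R}$; $f\in\mathcal{R}$ and $\lambda>0$ imply $\lambda f\in\mathcal{R}$; $f_1,f_2\in\mathcal{R}$ implies $f_1+f_2\in\mathcal{R}$. For a permutation $\pi$ of $\{1,\dots,n\}$ put $\pi(x_1,\dots,x_n)=(x_{\pi(1)},\dots,x_{\pi(n)})$ and $\pi^tf=f\circ\pi$. A coherent set $\mathcal{R}\subseteq\mathcal{G}(\mathcal{X}^n)$ is exchangeable if $h+(f-\pi^tf)\in\mathcal{R}$ for all $h\in\mathcal{R}$, $f\in\mathcal{G}(\mathcal{X}^n)$ and all permutations $\pi$. For $n\geq1$, $\mathcal{N}^n=\{m\in\mathbb{Z}_{\geq0}^{\mathcal{X}}:\sum_zm_z=n\}$; for $m\in\mathcal{N}^n$, $[m]$ is the set of $x\in\mathcal{X}^n$ in which each $z\in\mathcal{X}$ occurs exactly $m_z$ times (those with count vector $m$), and $|[m]|=n!/\prod_zm_z!$. $\mathrm{Hy}^n:\mathcal{G}(\mathcal{X}^n)\to\mathcal{G}(\mathcal{N}^n)$ is $\mathrm{Hy}^n(f)(m)=\frac1{|[m]|}\sum_{y\in[m]}f(y)$. The count representation of a coherent exchangeable $\mathcal{R}\subseteq\mathcal{G}(\mathcal{X}^n)$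 is $\mathrm{Hy}^n(\mathcal{R})$. With $C_{\check m}=[\check m]\times\mathcal{X}^{\hat n}\subseteq\mathcal{X}^N$ and $fI_{C_{\check m}}$ the gamble $(y,z)\mapsto f(z)I_{C_{\check m}}(y,z)$ on $\mathcal{X}^{\check n}\times\mathcal{X}^{\hat n}$, define $\mathcal{R}\rfloor\check m=\{f\in\mathcal{G}(\mathcal{X}^{\hat n}):fI_{C_{\check m}}\in\mathcal{R}\}$. For any $\check x\in[\check m]$ this coincides with $\mathcal{R}\rfloor\check x=\{f\in\mathcal{G}(\mathcal{X}^{\hat n}):fI_{\{\check x\}\times\mathcal{X}^{\hat n}}\in\mathcal{R}\}$. The likelihood function $L_{\check m}:\mathcal{N}^{\hat n}\to\mathbb{R}$ is $L_{\check m}(\hat m)=\frac{|[\check m]|\,|[\hat m]|}{|[\check m+\hat m]|}$, and $L_{\check m}g$ is the pointwise product. The linear map $+_{\check m}:\mathcal{G}(\mathcal{N}^{\hat n})\to\mathcal{G}(\mathcal{N}^N)$ is given by $(+_{\check m}g)(M)=g(M-\check m)$ if $M\geq\check m$ (componentwise), and $0$ otherwise. *)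

theory Defs
  imports "HOL-Analysis.Analysis" "HOL-Combinatorics.Permutations"
begin

text \<open>A gamble on a set \<open>\<Omega>\<close> is represented by its unique extension that is
  \<open>undefined\<close> outside \<open>\<Omega>\<close>, so that equality of gambles is equality of functions.\<close>

definition gambles :: "'a set \<Rightarrow> ('a \<Rightarrow> real) set" where
  "gambles \<Omega> = {f \<in> extensional \<Omega>. bounded (f ` \<Omega>)}"

definition gamble_zero :: "'a set \<Rightarrow> 'a \<Rightarrow> real" where
  "gamble_zero \<Omega> = (\<lambda>\<omega>\<in>\<Omega>. 0)"

definition gamble_add :: "'a set \<Rightarrow> ('a \<Rightarrow> real) \<Rightarrow> ('a \<Rightarrow> real) \<Rightarrow> 'a \<Rightarrow> real" where
  "gamble_add \<Omega> f g = (\<lambda>\<omega>\<in>\<Omega>. f \<omega> + g \<omega>)"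

definition gamble_diff :: "'a set \<Rightarrow> ('a \<Rightarrow> real) \<Rightarrow> ('a \<Rightarrow> real) \<Rightarrow> 'a \<Rightarrow> real" where
  "gamble_diff \<Omega> f g = (\<lambda>\<omega>\<in>\<Omega>. f \<omega> - g \<omega>)"

definition gamble_scale :: "'a set \<Rightarrow> real \<Rightarrow> ('a \<Rightarrow> real) \<Rightarrow> 'a \<Rightarrow> real" where
  "gamble_scale \<Omega> c f = (\<lambda>\<omega>\<in>\<Omega>. c * f \<omega>)"

definition gamble_less :: "'a set \<Rightarrow> ('a \<Rightarrow> real) \<Rightarrow> ('a \<Rightarrow> real) \<Rightarrow> bool" where
  "gamble_less \<Omega> f g \<longleftrightarrow> (\<forall>\<omega>\<in>\<Omega>. f \<omega> \<le> g \<omega>) \<and> f \<noteq> g"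

definition coherent :: "'a set \<Rightarrow> ('a \<Rightarrow> real) set \<Rightarrow> bool" where
  "coherent \<Omega> R \<longleftrightarrow>
     R \<subseteq> gambles \<Omega> \<and>
     gamble_zero \<Omega> \<notin> R \<and>
     (\<forall>f\<in>gambles \<Omega>. gamble_less \<Omega> (gamble_zero \<Omega>) f \<longrightarrow> f \<in> R) \<and>
     (\<forall>f\<in>R. \<forall>c>0. gamble_scale \<Omega> c f \<in> R) \<and>
     (\<forall>f\<in>R. \<forall>g\<in>R. gamble_add \<Omega> f g \<in> R)"

text \<open>Elements of \<open>\<X>\<^sup>n\<close> are lists of length \<open>n\<close> over a finite type. Positions are numbered
  from \<open>0\<close> to \<open>n - 1\<close>, and \<open>permute_list \<pi> [x\<^sub>0, \<dots>, x\<^sub>n\<^sub>-\<^sub>1] = [x\<^sub>\<pi>\<^sub>0, \<dots>]\<close>.\<close>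

definition tuples :: "nat \<Rightarrow> 'x list set" where
  "tuples n = {xs. length xs = n}"

definition perm_gamble :: "nat \<Rightarrow> (nat \<Rightarrow> nat) \<Rightarrow> ('x list \<Rightarrow> real) \<Rightarrow> 'x list \<Rightarrow> real" where
  "perm_gamble n \<pi> f = (\<lambda>x\<in>tuples n. f (permute_list \<pi> x))"

definition exchangeable :: "nat \<Rightarrow> ('x list \<Rightarrow> real) set \<Rightarrow> bool" where
  "exchangeable n R \<longleftrightarrow>
     (\<forall>h\<in>R. \<forall>f\<in>gambles (tuples n). \<forall>\<pi>. \<pi> permutes {..<n} \<longrightarrow>
        gamble_add (tuples n) h (gamble_diff (tuples n) f (perm_gamble n \<pi> f)) \<in> R)"

definition count_vectors :: "nat \<Rightarrow> ('x::finite \<Rightarrow> nat) set" where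
  "count_vectors n = {m. (\<Sum>z\<in>UNIV. m z) = n}"

definition count_class :: "('x::finite \<Rightarrow> nat) \<Rightarrow> 'x list set" where
  "count_class m = {x \<in> tuples (\<Sum>z\<in>UNIV. m z). \<forall>z. count_list x z = m z}"

definition Hy :: "nat \<Rightarrow> ('x::finite list \<Rightarrow> real) \<Rightarrow> ('x \<Rightarrow> nat) \<Rightarrow> real" where
  "Hy n f = (\<lambda>m\<in>count_vectors n.
     1 / real (card (count_class m)) * (\<Sum>y\<in>count_class m. f y))"

definition count_representation ::
    "nat \<Rightarrow> ('x::finite list \<Rightarrow> real) set \<Rightarrow> (('x \<Rightarrow> nat) \<Rightarrow> real) set" where
  "count_representation n R = Hy n ` R"

text \<open>The sets \<open>\<X>\<^sup>k \<times> \<X>\<^sup>l\<close> and \<open>\<X>\<^sup>k\<^sup>+\<^sup>l\<close> are identified by appending lists; for \<open>x\<close> of length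
  \<open>k + l\<close>, the two components are \<open>take k x\<close> and \<open>drop k x\<close>.\<close>

definition cylinder :: "'x::finite list set \<Rightarrow> nat \<Rightarrow> 'x list set" where
  "cylinder B l = {y @ z | y z. y \<in> B \<and> z \<in> tuples l}"

definition extend_gamble ::
    "nat \<Rightarrow> nat \<Rightarrow> 'x::finite list set \<Rightarrow> ('x list \<Rightarrow> real) \<Rightarrow> 'x list \<Rightarrow> real" where
  "extend_gamble k l B f =
     (\<lambda>x\<in>tuples (k + l). f (drop k x) * indicator (cylinder B l) x)"

definition update_count ::
    "nat \<Rightarrow> nat \<Rightarrow> ('x::finite list \<Rightarrow> real) set \<Rightarrow> ('x \<Rightarrow> nat) \<Rightarrow> ('x list \<Rightarrow> real) set" where
  "update_count k l R m = {f \<in> gambles (tuples l). extend_gamble k l (count_class m) f \<in> R}"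

definition likelihood :: "('x::finite \<Rightarrow> nat) \<Rightarrow> ('x \<Rightarrow> nat) \<Rightarrow> real" where
  "likelihood m m' =
     real (card (count_class m)) * real (card (count_class m'))
       / real (card (count_class (\<lambda>z. m z + m' z)))"

definition likelihood_mult ::
    "nat \<Rightarrow> ('x::finite \<Rightarrow> nat) \<Rightarrow> (('x \<Rightarrow> nat) \<Rightarrow> real) \<Rightarrow> ('x \<Rightarrow> nat) \<Rightarrow> real" where
  "likelihood_mult l m g = (\<lambda>m'\<in>count_vectors l. likelihood m m' * g m')"

definition plus_count ::
    "nat \<Rightarrow> ('x::finite \<Rightarrow> nat) \<Rightarrow> (('x \<Rightarrow> nat) \<Rightarrow> real) \<Rightarrow> ('x \<Rightarrow> nat) \<Rightarrow> real" where
  "plus_count N m g =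
     (\<lambda>M\<in>count_vectors N. if m \<le> M then g (\<lambda>z. M z - m z) else 0)"

end

theory Submission
  imports Defs
begin

text \<open>A coherent exchangeable set is a union of fibres of \<open>Hy\<close>: if \<open>Hy h = Hy f\<close>, then the
  average of \<open>f - h\<close> over all permutations of the positions vanishes, so \<open>f - h\<close> is the mean of
  the differences \<open>(f - h) - \<pi>\<^sup>t(f - h)\<close>, and \<open>f\<close> arises from \<open>h\<close> by finitely many exchangeability
  steps. Since \<open>Hy\<close> sends the extension of \<open>f\<close> to \<open>+(L \<cdot> Hy f)\<close>, and every gamble \<open>g\<close> on count
  vectors is \<open>Hy\<close> of the gamble \<open>z \<mapsto> g (count vector of z)\<close>, both inclusions follow.\<close>

section \<open>Count classes and count vectors\<close>

lemma finite_tuples [simp]: "finite (tuples n :: 'x::finite list set)"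
  using finite_lists_length_eq[of "UNIV :: 'x set" n] by (simp add: tuples_def)

lemma sum_count_list_UNIV: "(\<Sum>z\<in>UNIV. count_list (xs :: 'x::finite list) z) = length xs"
  by (rule sum_count_set) auto

lemma count_class_eq: "count_class m = {xs. count_list xs = m}"
  by (auto simp: count_class_def tuples_def simp flip: sum_count_list_UNIV)

lemma count_class_subset_tuples: "m \<in> count_vectors n \<Longrightarrow> count_class m \<subseteq> tuples n"
  by (auto simp: count_class_def count_vectors_def)

lemma finite_count_class [simp]: "finite (count_class m)"
  by (rule finite_subset[of _ "tuples (\<Sum>z\<in>UNIV. m z)"]) (auto simp: count_class_def)

text \<open>On a finite type every function to \<open>nat\<close> is the multiplicity function of a
  multiset, and listing that multiset gives a member of the class. All later divisions by
  \<open>card (count_class m)\<close> rest on this.\<close>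

lemma count_class_nonempty: "count_class (m :: 'x::finite \<Rightarrow> nat) \<noteq> {}"
proof -
  obtain xs where "mset xs = Abs_multiset m"
    using ex_mset by blast
  then have "count_list xs = m"
    by (simp add: fun_eq_iff flip: count_mset)
  then show ?thesis
    by (auto simp: count_class_eq)
qed

text \<open>Since no class is empty, \<open>count_list\<close> maps the finite set of tuples onto
  the count vectors. Boundedness of gambles on count vectors is then automatic.\<close>

lemma finite_count_vectors [simp]: "finite (count_vectors n :: ('x::finite \<Rightarrow> nat) set)"
proof -
  have "count_vectors n \<subseteq> count_list ` (tuples n :: 'x list set)"
  proof
    fix m :: "'x \<Rightarrow> nat"
    assume m: "m \<in> count_vectors n"
    obtain xs where "xs \<in> count_class m"
      using count_class_nonempty by blast
    with count_class_subset_tuples[OF m] show "m \<in> count_list ` (tuples n :: 'x list set)"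
      by (auto simp: count_class_eq)
  qed
  then show ?thesis
    by (rule finite_subset) simp
qed

lemma finite_gambles_iff: "finite A \<Longrightarrow> f \<in> gambles A \<longleftrightarrow> f \<in> extensional A"
  by (auto simp: gambles_def intro: finite_imp_bounded)

section \<open>Averaging over permutations of the positions\<close>

lemma sum_count_class_eq_0:
  assumes "Hy n f = Hy n h" "length x = n"
  shows "(\<Sum>y\<in>count_class (count_list x). f y - h y) = 0"
proof -
  let ?m = "count_list x"
  have m: "?m \<in> count_vectors n"
    using assms(2) by (simp add: count_vectors_def sum_count_list_UNIV)
  have "card (count_class ?m) \<noteq> 0"
    using count_class_nonempty[of ?m] by simp
  then show ?thesis
    using fun_cong[OF assms(1), of ?m] m by (simp add: Hy_def sum_subtractf)
qed

text \<open>Some permutation \<sigma> carries \<open>x\<close> to \<open>y\<close>, and \<pi>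
  \<mapsto> \<open>\<sigma> \<circ> \<pi>\<close> is a bijection of the permutation group, so it
  only reorders the sum.\<close>

lemma sum_permutations_permute_list_eq:
  assumes "mset x = mset y" and n: "length x = n"
  shows "(\<Sum>\<pi> | \<pi> permutes {..<n}. d (permute_list \<pi> y)) =
         (\<Sum>\<pi> | \<pi> permutes {..<n}. d (permute_list \<pi> x))"
proof -
  obtain \<sigma> where \<sigma>: "\<sigma> permutes {..<n}" "permute_list \<sigma> x = y"
    using mset_eq_permutation[OF assms(1)[symmetric]] n assms(1) mset_eq_length by metis
  \<comment> \<open>Since \<open>permute_list\<close> reverses the order of composition, \<sigma>
    has to stand on the left in order to be applied to \<open>x\<close> first.\<close>
  have "(\<Sum>\<pi> | \<pi> permutes {..<n}. d (permute_list \<pi> x)) =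
        (\<Sum>\<pi> | \<pi> permutes {..<n}. d (permute_list (\<sigma> \<circ> \<pi>) x))"
    using setum_permutations_compose_left[OF \<sigma>(1), of "\<lambda>\<pi>. d (permute_list \<pi> x)"]
    by simp
  also have "\<dots> = (\<Sum>\<pi> | \<pi> permutes {..<n}. d (permute_list \<pi> y))"
    using \<sigma> n by (intro sum.cong) (auto simp: permute_list_compose)
  finally show ?thesis ..
qed

text \<open>Permuting positions leaves counts unchanged, so it is a bijection of the class onto
  itself, with inverse \<open>permute_list (inv \<pi>)\<close>.\<close>

lemma sum_count_class_permute_list:
  assumes "\<pi> permutes {..<n}" and "m \<in> count_vectors n"
  shows "(\<Sum>y\<in>count_class m. d (permute_list \<pi> y)) = (\<Sum>y\<in>count_class m. d y)"
proof -
  have len: "length y = n" if "y \<in> count_class m" for y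
    using count_class_subset_tuples[OF assms(2)] that by (auto simp: tuples_def)
  have closed: "permute_list \<sigma> y \<in> count_class m"
    if "\<sigma> permutes {..<n}" "y \<in> count_class m" for \<sigma> y
    using that len[OF that(2)]
    by (auto simp: count_class_eq fun_eq_iff simp flip: count_mset)
  have inv: "inv \<pi> permutes {..<n}"
    by (rule permutes_inv[OF assms(1)])
  have comp: "permute_list (inv \<pi>) (permute_list \<pi> y) = y"
    "permute_list \<pi> (permute_list (inv \<pi>) y) = y" if "y \<in> count_class m" for y
    using assms(1) inv len[OF that]
    by (simp_all add: permutes_inv_o flip: permute_list_compose)
  show ?thesis
    by (rule sum.reindex_bij_witness[of _ "permute_list (inv \<pi>)" "permute_list \<pi>"])
      (simp_all add: comp closed assms(1) inv)
qed

text \<open>Double counting: \<open>?A\<close> is constant on the class of \<open>x\<close>, and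
  summing it over the class and swapping the sums leaves, for each \<pi>, the total of
  \<open>d\<close> over the class, which is 0. This avoids counting the permutations that carry
  \<open>x\<close> to a given tuple.\<close>

lemma sum_permutations_eq_0:
  assumes "(\<Sum>y\<in>count_class (count_list x). d y) = (0::real)" and n: "length x = n"
  shows "(\<Sum>\<pi> | \<pi> permutes {..<n}. d (permute_list \<pi> x)) = 0"
proof -
  let ?m = "count_list x" and ?A = "\<lambda>y. \<Sum>\<pi> | \<pi> permutes {..<n}. d (permute_list \<pi> y)"
  have m: "?m \<in> count_vectors n"
    using n by (simp add: count_vectors_def sum_count_list_UNIV)
  have "?A y = ?A x" if "y \<in> count_class ?m" for y
  proof (rule sum_permutations_permute_list_eq[OF _ n])
    show "mset x = mset y"
      using that by (auto intro!: multiset_eqI simp: count_class_eq count_mset)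
  qed
  then have "real (card (count_class ?m)) * ?A x = (\<Sum>y\<in>count_class ?m. ?A y)"
    by simp
  also have "\<dots> = (\<Sum>\<pi> | \<pi> permutes {..<n}. \<Sum>y\<in>count_class ?m. d (permute_list \<pi> y))"
    by (rule sum.swap)
  also have "\<dots> = (\<Sum>\<pi> | \<pi> permutes {..<n}. 0)"
    by (rule sum.cong) (simp_all add: sum_count_class_permute_list[OF _ m] assms(1))
  finally show ?thesis
    using count_class_nonempty[of ?m] by simp
qed

lemma exchangeable_add_sum:
  fixes R :: "('x::finite list \<Rightarrow> real) set"
  assumes R: "exchangeable n R" "R \<subseteq> gambles (tuples n)"
    and "h \<in> R" and "finite P" and "\<And>\<pi>. \<pi> \<in> P \<Longrightarrow> \<pi> permutes {..<n}"
  shows "(\<lambda>x\<in>tuples n. h x + (\<Sum>\<pi>\<in>P. d x - d (permute_list \<pi> x))) \<in> R"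
  using assms(4,5)
proof (induction P)
  case empty
  have "(\<lambda>x\<in>tuples n. h x) = h"
    using R(2) \<open>h \<in> R\<close> by (intro extensional_restrict) (auto simp: gambles_def)
  then show ?case
    using \<open>h \<in> R\<close> by simp
next
  case (insert \<pi> P)
  let ?T = "tuples n :: 'x list set"
  let ?h = "\<lambda>x\<in>?T. h x + (\<Sum>\<pi>\<in>P. d x - d (permute_list \<pi> x))"
  \<comment> \<open>The restriction turns the arbitrary function \<open>d\<close> into a gamble; its
    values at permuted tuples are kept because permuting preserves length.\<close>
  let ?d = "\<lambda>x\<in>?T. d x"
  have "gamble_add ?T ?h (gamble_diff ?T ?d (perm_gamble n \<pi> ?d)) \<in> R"
  proof -
    have "?d \<in> gambles ?T" "\<pi> permutes {..<n}"
      using insert.prems by (simp_all add: finite_gambles_iff)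
    moreover have "?h \<in> R"
      using insert by blast
    ultimately show ?thesis
      using R(1) unfolding exchangeable_def by blast
  qed
  also have "gamble_add ?T ?h (gamble_diff ?T ?d (perm_gamble n \<pi> ?d)) =
      (\<lambda>x\<in>?T. h x + (\<Sum>\<pi>\<in>insert \<pi> P. d x - d (permute_list \<pi> x)))"
    using insert by (auto simp: gamble_add_def gamble_diff_def perm_gamble_def tuples_def)
  finally show ?case .
qed

lemma exchangeable_Hy_fibre:
  fixes R :: "('x::finite list \<Rightarrow> real) set"
  assumes R: "exchangeable n R" "R \<subseteq> gambles (tuples n)"
    and "h \<in> R" and f: "f \<in> gambles (tuples n)" and Hy: "Hy n f = Hy n h"
  shows "f \<in> R"
proof -
  let ?P = "{\<pi>. \<pi> permutes {..<n}}"
  let ?c = "real (card ?P)"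
  have fin: "finite ?P"
    by (simp add: finite_permutations)
  then have c: "?c \<noteq> 0"
    using permutes_id[of "{..<n}"] by (auto simp: card_eq_0_iff simp del: permutes_id)
  \<comment> \<open>With this scaling the \<open>?c\<close> copies of \<open>d x\<close> add up to
    \<open>f x - h x\<close>, while the permuted terms cancel.\<close>
  define d where "d = (\<lambda>x. (f x - h x) / ?c)"
  have "h x + (\<Sum>\<pi>\<in>?P. d x - d (permute_list \<pi> x)) = f x" if "length x = n" for x
  proof -
    have "(\<Sum>y\<in>count_class (count_list x). d y) = 0"
      using sum_count_class_eq_0[OF Hy that] by (simp add: d_def flip: sum_divide_distrib)
    then have "(\<Sum>\<pi>\<in>?P. d (permute_list \<pi> x)) = 0"
      by (rule sum_permutations_eq_0[OF _ that])
    then show ?thesis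
      using c by (simp add: sum_subtractf) (simp add: d_def)
  qed
  then have "(\<lambda>x\<in>tuples n. h x + (\<Sum>\<pi>\<in>?P. d x - d (permute_list \<pi> x))) = (\<lambda>x\<in>tuples n. f x)"
    by (auto simp: tuples_def)
  also have "\<dots> = f"
    using f by (intro extensional_restrict) (auto simp: gambles_def)
  finally show ?thesis
    using exchangeable_add_sum[OF R \<open>h \<in> R\<close> fin, of d] by simp
qed

section \<open>Extended gambles under \<open>Hy\<close>\<close>

text \<open>Cutting at position \<open>k\<close> identifies the part of \<open>count_class M\<close>
  in the cylinder with a product of two classes. The summand ignores the first component, whence the
  factor \<open>card (count_class m)\<close>.\<close>

lemma sum_count_class_extend_gamble:
  fixes m :: "'x::finite \<Rightarrow> nat"
  assumes m: "m \<in> count_vectors k" and M: "M \<in> count_vectors (k + l)"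
  shows "(\<Sum>x\<in>count_class M. extend_gamble k l (count_class m) f x) =
    (if m \<le> M
     then real (card (count_class m)) * (\<Sum>z\<in>count_class (\<lambda>z. M z - m z). f z) else 0)"
proof -
  let ?C = "cylinder (count_class m) l"
  have len: "length y = k" if "y \<in> count_class m" for y
    using count_class_subset_tuples[OF m] that by (auto simp: tuples_def)
  have "(\<Sum>x\<in>count_class M. extend_gamble k l (count_class m) f x) =
      (\<Sum>x\<in>count_class M. f (drop k x) * indicator ?C x)"
    using count_class_subset_tuples[OF M]
    by (intro sum.cong) (auto simp: extend_gamble_def)
  also have "\<dots> = (\<Sum>x\<in>count_class M \<inter> ?C. f (drop k x))"
    by (simp add: indicator_def sum.inter_restrict if_distrib[of "(*) _"] cong: if_cong)
  also have "\<dots> = (if m \<le> M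
     then real (card (count_class m)) * (\<Sum>z\<in>count_class (\<lambda>z. M z - m z). f z) else 0)"
  proof (cases "m \<le> M")
    case True
    let ?m' = "\<lambda>z. M z - m z"
    have m': "?m' \<in> count_vectors l"
      using True m M by (auto simp: count_vectors_def le_fun_def sum_subtractf_nat)
    have "(\<Sum>x\<in>count_class M \<inter> ?C. f (drop k x)) =
        (\<Sum>(y, z)\<in>count_class m \<times> count_class ?m'. f z)"
    proof (rule sum.reindex_bij_witness[of _ "\<lambda>(y, z). y @ z" "\<lambda>x. (take k x, drop k x)"])
      fix p
      assume "p \<in> count_class m \<times> count_class ?m'"
      then show "(case p of (y, z) \<Rightarrow> y @ z) \<in> count_class M \<inter> ?C"
        using True count_class_subset_tuples[OF m']
        by (auto simp: count_class_eq cylinder_def fun_eq_iff le_fun_def)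
    qed (use len in \<open>auto simp: count_class_eq cylinder_def\<close>)
    then show ?thesis
      using True by (simp add: sum.cartesian_product[symmetric])
  next
    case False
    \<comment> \<open>Counts add under append, so a common element would force
      \<open>m \<le> M\<close>.\<close>
    have "count_class M \<inter> ?C = {}"
      using False by (auto simp: count_class_eq cylinder_def le_fun_def)
    with False show ?thesis
      by simp
  qed
  finally show ?thesis .
qed

text \<open>After division by the size of \<open>count_class M\<close>, the numerator factor for
  \<open>M - m\<close> in the likelihood cancels the normalisation of \<open>Hy l f\<close>.\<close>

lemma Hy_extend_gamble:
  fixes m :: "'x::finite \<Rightarrow> nat"
  assumes m: "m \<in> count_vectors k"
  shows "Hy (k + l) (extend_gamble k l (count_class m) f) =
    plus_count (k + l) m (likelihood_mult l m (Hy l f))"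
proof
  fix M :: "'x \<Rightarrow> nat"
  show "Hy (k + l) (extend_gamble k l (count_class m) f) M =
    plus_count (k + l) m (likelihood_mult l m (Hy l f)) M"
  proof (cases "M \<in> count_vectors (k + l) \<and> m \<le> M")
    case True
    let ?m' = "\<lambda>z. M z - m z"
    have m': "?m' \<in> count_vectors l"
      using True m by (auto simp: count_vectors_def le_fun_def sum_subtractf_nat)
    have "(\<lambda>z. m z + ?m' z) = M"
      using True by (auto simp: le_fun_def)
    moreover have "card (count_class ?m') \<noteq> 0"
      using count_class_nonempty[of ?m'] by simp
    ultimately show ?thesis
      using True m' sum_count_class_extend_gamble[OF m, of M l f]
      by (simp add: Hy_def plus_count_def likelihood_mult_def likelihood_def)
  next
    case False
    then show ?thesis
      using sum_count_class_extend_gamble[OF m, of M l f]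
      by (auto simp: Hy_def plus_count_def)
  qed
qed

text \<open>The composed gamble is constant on each count class, so averaging returns its value:
  composition with \<open>count_list\<close> is a right inverse of \<open>Hy l\<close>.\<close>

lemma Hy_comp_count_list:
  fixes g :: "('x::finite \<Rightarrow> nat) \<Rightarrow> real"
  assumes "g \<in> extensional (count_vectors l)"
  shows "Hy l (\<lambda>z\<in>tuples l. g (count_list z)) = g"
proof
  fix m :: "'x \<Rightarrow> nat"
  show "Hy l (\<lambda>z\<in>tuples l. g (count_list z)) m = g m"
  proof (cases "m \<in> count_vectors l")
    case True
    have "(\<Sum>y\<in>count_class m. (\<lambda>z\<in>tuples l. g (count_list z)) y) =
        (\<Sum>y\<in>count_class m. g m)"
      using count_class_subset_tuples[OF True] by (intro sum.cong) (auto simp: count_class_eq)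
    then show ?thesis
      using True count_class_nonempty[of m] by (simp add: Hy_def)
  next
    case False
    then show ?thesis
      using assms by (simp add: Hy_def extensional_def)
  qed
qed

theorem proposition20:
  fixes n_check n_hat N :: nat
    and R :: "('x::finite list \<Rightarrow> real) set"
    and S :: "(('x \<Rightarrow> nat) \<Rightarrow> real) set"
    and m_check :: "'x \<Rightarrow> nat"
  assumes "n_check \<ge> 1" and "n_hat \<ge> 1" and "N = n_check + n_hat"
    and "coherent (tuples N) R"
    and "exchangeable N R"
    and "S = count_representation N R"
    and "m_check \<in> count_vectors n_check"
  shows "count_representation n_hat (update_count n_check n_hat R m_check) =
    {g \<in> gambles (count_vectors n_hat).
       plus_count N m_check (likelihood_mult n_hat m_check g) \<in> S}"
proof (intro equalityI subsetI)
  fix g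
  assume "g \<in> count_representation n_hat (update_count n_check n_hat R m_check)"
  then obtain f where f: "extend_gamble n_check n_hat (count_class m_check) f \<in> R"
    and g: "g = Hy n_hat f"
    by (auto simp: count_representation_def update_count_def)
  have "g \<in> gambles (count_vectors n_hat)"
    by (simp add: finite_gambles_iff g Hy_def)
  moreover have "plus_count N m_check (likelihood_mult n_hat m_check g) \<in> S"
    using f Hy_extend_gamble[OF assms(7), of n_hat f, symmetric] assms(3,6)
    by (simp add: g count_representation_def)
  ultimately show "g \<in> {g \<in> gambles (count_vectors n_hat).
      plus_count N m_check (likelihood_mult n_hat m_check g) \<in> S}"
    by simp
next
  fix g
  assume "g \<in> {g \<in> gambles (count_vectors n_hat).
      plus_count N m_check (likelihood_mult n_hat m_check g) \<in> S}"
  then obtain h where g: "g \<in> gambles (count_vectors n_hat)" and h: "h \<in> R"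
    "plus_count N m_check (likelihood_mult n_hat m_check g) = Hy N h"
    using assms(6) by (auto simp: count_representation_def)
  define f where "f = (\<lambda>z\<in>tuples n_hat. g (count_list z))"
  have Hy_f: "Hy n_hat f = g"
    unfolding f_def using g by (intro Hy_comp_count_list) (simp add: gambles_def)
  \<comment> \<open>The gamble \<open>h\<close> need not be an extended one; it only has the same
    image under \<open>Hy N\<close> as the extension of \<open>f\<close>, and membership in
    \<open>R\<close> passes along this fibre.\<close>
  have "extend_gamble n_check n_hat (count_class m_check) f \<in> R"
  proof (rule exchangeable_Hy_fibre[OF assms(5) _ h(1)])
    show "R \<subseteq> gambles (tuples N)"
      using assms(4) by (simp add: coherent_def)
    show "extend_gamble n_check n_hat (count_class m_check) f \<in> gambles (tuples N)"
      by (simp add: finite_gambles_iff extend_gamble_def assms(3))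
    show "Hy N (extend_gamble n_check n_hat (count_class m_check) f) = Hy N h"
      using Hy_extend_gamble[OF assms(7), of n_hat f] h(2) Hy_f assms(3) by simp
  qed
  moreover have "f \<in> gambles (tuples n_hat)"
    by (simp add: finite_gambles_iff f_def)
  ultimately show "g \<in> count_representation n_hat (update_count n_check n_hat R m_check)"
    using Hy_f by (auto simp: count_representation_def update_count_def)
qed

end
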